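(* Let $m,n,r$ be nonnegative integers. Then $$\mathrm{tr}(x^my^mx^ny^n)=\mathrm{tr}(y^mx^my^nx^n)$$ is valid for all $x,y\in M_2(\mathbb{C})$. If $m,n,r$ are not distinct (i.e. at least two of them are equal), then $$\mathrm{tr}(x^my^mx^ny^nx^ry^r)=\mathrm{tr}(y^mx^my^nx^ny^rx^r)$$ is also valid for all $x,y\in M_2(\mathbb{C})$.
   Context: $M_2(\mathbb{C})$ is the algebra of $2\times2$ complex matrices and $\mathrm{tr}$ is the usual matrix trace. *)

theory Defs
  imports "HOL-Analysis.Analysis"
begin

(* The overloaded power on the type 'a^'n^'n comes from the componentwise product,
   so the power with respect to the matrix product is defined separately. *)
primrec matpow :: "'a::semiring_1^'n^'n \<Rightarrow> nat \<Rightarrow> 'a^'n^'n" where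
  "matpow A 0 = mat 1"
| "matpow A (Suc k) = A ** matpow A k"

end

theory Submission
  imports Defs
begin

text \<open>By Cayley-Hamilton every power of a $2 \times 2$ matrix $x$ lies in the span of $1$ and $x$.
  Hence the first identity is multilinear in the four powers and reduces to the cases where each of
  them is $1$ or the base matrix, which are all cyclic rotations. For the second identity, two equal
  exponents turn the products, up to rotation, into $ABABCD$ and $BABADC$; as $AB$ and $BA$ have the
  same trace and determinant, Cayley-Hamilton for both reduces the claim to the first identity.\<close>

lemmas mat2_simps = vec_eq_iff forall_2 matrix_matrix_mult_def mat_def sum_2 trace_def det_2

lemma matpow_2_eq:
  fixes x :: "'a::comm_ring_1^2^2"
  obtains p q where "matpow x k = mat p + mat q ** x"
proof -
  have "\<exists>p q. matpow x k = mat p + mat q ** x"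
  proof (induction k)
    case 0
    have "matpow x 0 = mat 1 + mat 0 ** x"
      by (simp add: mat2_simps)
    then show ?case by blast
  next
    case (Suc k)
    then obtain p q where "matpow x k = mat p + mat q ** x" by blast
    \<comment> \<open>Multiplying by \<open>x\<close> creates \<open>q\<close> times the square of
      \<open>x\<close>, which Cayley-Hamilton replaces by \<open>trace x\<close> times
      \<open>x\<close> minus \<open>det x\<close>.\<close>
    then have "matpow x (Suc k) = mat (- q * det x) + mat (p + q * trace x) ** x"
      by (simp add: mat2_simps algebra_simps)
    then show ?case by blast
  qed
  then show thesis using that by blast
qed

lemma trace_matpow_swap_2:
  fixes x y :: "'a::comm_ring_1^2^2"
  shows "trace (matpow x i ** matpow y j ** matpow x k ** matpow y l) =
         trace (matpow y j ** matpow x i ** matpow y l ** matpow x k)"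
proof -
  obtain a b where 1: "matpow x i = mat a + mat b ** x" by (rule matpow_2_eq)
  obtain c d where 2: "matpow y j = mat c + mat d ** y" by (rule matpow_2_eq)
  obtain e f where 3: "matpow x k = mat e + mat f ** x" by (rule matpow_2_eq)
  obtain g h where 4: "matpow y l = mat g + mat h ** y" by (rule matpow_2_eq)
  show ?thesis
    unfolding 1 2 3 4 by (simp add: mat2_simps algebra_simps)
qed

text \<open>Multiply the Cayley-Hamilton relation for \<open>M\<close> by \<open>N\<close> on the
  right and take traces.\<close>

lemma trace_square_mult_2:
  fixes M N :: "'a::comm_ring_1^2^2"
  shows "trace (M ** M ** N) = trace M * trace (M ** N) - det M * trace N"
  by (simp add: mat2_simps algebra_simps)

lemma trace_ABABCD_2:
  fixes A B C D :: "'a::comm_ring_1^2^2"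
  assumes "trace (A ** B ** C ** D) = trace (B ** A ** D ** C)"
  shows "trace (A ** B ** A ** B ** C ** D) = trace (B ** A ** B ** A ** D ** C)"
  using trace_square_mult_2[of "A ** B" "C ** D"] trace_square_mult_2[of "B ** A" "D ** C"] assms
  by (simp add: matrix_mul_assoc trace_mul_sym[of A B] trace_mul_sym[of C D] det_mul mult.commute)

theorem corollary4p4:
  fixes m n r :: nat
  shows "(\<forall>x y :: complex^2^2.
            trace (matpow x m ** matpow y m ** matpow x n ** matpow y n) =
            trace (matpow y m ** matpow x m ** matpow y n ** matpow x n)) \<and>
         (m = n \<or> m = r \<or> n = r \<longrightarrow>
          (\<forall>x y :: complex^2^2.
            trace (matpow x m ** matpow y m ** matpow x n ** matpow y n ** matpow x r ** matpow y r) =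
            trace (matpow y m ** matpow x m ** matpow y n ** matpow x n ** matpow y r ** matpow x r)))"
proof (intro conjI impI allI)
  fix x y :: "complex^2^2"
  show "trace (matpow x m ** matpow y m ** matpow x n ** matpow y n) =
        trace (matpow y m ** matpow x m ** matpow y n ** matpow x n)"
    by (rule trace_matpow_swap_2)
next
  fix x y :: "complex^2^2"
  define P where "P k = matpow x k ** matpow y k" for k
  define Q where "Q k = matpow y k ** matpow x k" for k
  \<comment> \<open>Here \<open>A\<close>, \<open>B\<close> are the \<open>i\<close>-th powers of
    \<open>x\<close>, \<open>y\<close>, and \<open>C\<close>, \<open>D\<close> the
    \<open>j\<close>-th powers.\<close>
  have aab: "trace (P i ** P i ** P j) = trace (Q i ** Q i ** Q j)" for i j
    using trace_ABABCD_2[OF trace_matpow_swap_2[of x i y i j j]]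
    by (simp add: P_def Q_def matrix_mul_assoc)
  \<comment> \<open>Rotation makes the two equal factors adjacent and leading, so \<open>aab\<close>
    covers all three cases.\<close>
  have rotate: "trace (A ** B ** C) = trace (C ** A ** B)" for A B C :: "complex^2^2"
    using trace_mul_sym[of "A ** B" C] by (simp add: matrix_mul_assoc)
  assume "m = n \<or> m = r \<or> n = r"
  then have "trace (P m ** P n ** P r) = trace (Q m ** Q n ** Q r)"
    by (metis aab rotate)
  then show "trace (matpow x m ** matpow y m ** matpow x n ** matpow y n ** matpow x r ** matpow y r) =
             trace (matpow y m ** matpow x m ** matpow y n ** matpow x n ** matpow y r ** matpow x r)"
    by (simp add: P_def Q_def matrix_mul_assoc)
qed

end
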